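(* Let $S$ be a semigroup, let $F$ be a field with $\mathrm{char}(F)\neq 2$, and let $\sigma:S\to S$ be an involutive anti-automorphism. Suppose $f,g,h_1,h_2:S\to F$ satisfy \[ f(x\sigma(y))=f(x)h_1(y)+g(x)h_2(y)\qquad\text{for all }x,y\in S, \] where $\{f,g\}$ is linearly independent and $h_2\not\equiv 0$. Set $V:=\mathrm{span}\{f,g\}$ and $V^\sigma:=J(V)=\mathrm{span}\{Jf,Jg\}$. Then $V^\sigma$ is invariant under $L(y)$ for every $y\in S$ (i.e. $L(y)V^\sigma\subseteq V^\sigma$). Equivalently, $V$ is invariant under $R(\sigma(y))$ for every $y\in S$ (i.e. $R(\sigma(y))V\subseteq V$).
   Context: $\mathscr{F}(S,F)$ denotes the $F$-vector space of all functions $S\to F$; spans and linear independence are over $F$ in this space. An involutive anti-automorphism of $S$ is a bijective map $\sigma:S\to S$ with $\sigma(xy)=\sigma(y)\sigma(x)$ for all $x,y\in S$ and $\sigma^2=\mathrm{id}$. For $y\in S$ the linear operators $R(y),L(y)$ on $\mathscr{F}(S,F)$ are defined by $(R(y)h)(x):=h(xy)$ and $(L(y)h)(x):=h(yx)$. The linear operator $J$ on $\mathscr{F}(S,F)$ is defined by $(Jh)(x):=h(\sigma(x))$. *)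

theory Defs
  imports "HOL-Library.Function_Algebras" "HOL-Computational_Algebra.Computational_Algebra"
begin

definition fscale :: "'f::field \<Rightarrow> ('s \<Rightarrow> 'f) \<Rightarrow> 's \<Rightarrow> 'f"
  where "fscale c h = (\<lambda>x. c * h x)"

(* The F-vector space of all functions S -> F, with the pointwise addition of
   Function_Algebras and the pointwise scalar multiplication fscale. This provides
   fun_space.span and fun_space.independent. *)
global_interpretation fun_space: vector_space "fscale :: 'f::field \<Rightarrow> ('s \<Rightarrow> 'f) \<Rightarrow> 's \<Rightarrow> 'f"
  by unfold_locales (auto simp: fscale_def fun_eq_iff algebra_simps)

definition involutive_anti_automorphism :: "('s::semigroup_mult \<Rightarrow> 's) \<Rightarrow> bool"
  where "involutive_anti_automorphism \<sigma> \<longleftrightarrow>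
    bij \<sigma> \<and> (\<forall>x y. \<sigma> (x * y) = \<sigma> y * \<sigma> x) \<and> \<sigma> \<circ> \<sigma> = id"

definition right_op :: "'s::semigroup_mult \<Rightarrow> ('s \<Rightarrow> 'f::field) \<Rightarrow> 's \<Rightarrow> 'f"
  where "right_op y h = (\<lambda>x. h (x * y))"

definition left_op :: "'s::semigroup_mult \<Rightarrow> ('s \<Rightarrow> 'f::field) \<Rightarrow> 's \<Rightarrow> 'f"
  where "left_op y h = (\<lambda>x. h (y * x))"

definition compose_op :: "('s \<Rightarrow> 's) \<Rightarrow> ('s \<Rightarrow> 'f::field) \<Rightarrow> 's \<Rightarrow> 'f"
  where "compose_op \<sigma> h = (\<lambda>x. h (\<sigma> x))"

lemma linear_right_op: "Vector_Spaces.linear fscale fscale (right_op y)"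
  by unfold_locales (auto simp: right_op_def fscale_def fun_eq_iff algebra_simps)

lemma linear_left_op: "Vector_Spaces.linear fscale fscale (left_op y)"
  by unfold_locales (auto simp: left_op_def fscale_def fun_eq_iff algebra_simps)

lemma linear_compose_op: "Vector_Spaces.linear fscale fscale (compose_op \<sigma>)"
  by unfold_locales (auto simp: compose_op_def fscale_def fun_eq_iff algebra_simps)

end

theory Submission
  imports Defs
begin

text \<open>The functional equation says $R(\sigma(y))f = h_1(y) f + h_2(y) g$. Hence $V$ contains every
  right translate of $f$, and, as $h_2(y_0) \neq 0$ for some $y_0$, the function $g$ is itself a
  linear combination of $f$ and the right translate $R(\sigma(y_0))f$. Since $R(y)R(z) = R(yz)$, the
  right translates of $g$ lie in $V$ as well. The statement about $V^\sigma$ is transported by the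
  intertwining relation $L(y)J = JR(\sigma(y))$.\<close>

lemma right_op_right_op: "right_op y (right_op z h) = right_op (y * z) h"
  by (simp add: right_op_def mult.assoc)

text \<open>The coefficients \<open>a\<close>, \<open>b\<close> are indexed by the translating
  element itself, so one hypothesis also covers translates of \<open>f\<close> by products
  \<open>z * y\<^sub>0\<close>.\<close>

lemma right_op_span_pair_subset:
  assumes translate: "\<And>y. right_op y f = fscale (a y) f + fscale (b y) g"
    and "b y\<^sub>0 \<noteq> 0"
  shows "right_op z ` fun_space.span {f, g} \<subseteq> fun_space.span {f, g}"
proof -
  interpret R: Vector_Spaces.linear fscale fscale "right_op z :: ('a \<Rightarrow> 'b) \<Rightarrow> _"
    by (rule linear_right_op)
  have f: "right_op y f \<in> fun_space.span {f, g}" for y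
    unfolding translate
    by (intro fun_space.span_add fun_space.span_scale fun_space.span_base) auto
  have "g = fscale (inverse (b y\<^sub>0)) (right_op y\<^sub>0 f - fscale (a y\<^sub>0) f)"
    using \<open>b y\<^sub>0 \<noteq> 0\<close> by (simp add: translate)
  then have "right_op z g =
      fscale (inverse (b y\<^sub>0)) (right_op (z * y\<^sub>0) f - fscale (a y\<^sub>0) (right_op z f))"
    by (metis R.diff R.scale right_op_right_op)
  then have "right_op z g \<in> fun_space.span {f, g}"
    using f by (simp only: fun_space.span_diff fun_space.span_scale)
  then have "right_op z ` {f, g} \<subseteq> fun_space.span {f, g}"
    using f by blast
  \<comment> \<open>A linear map sends a span to the span of the images, so the two generators
    suffice.\<close>
  then show ?thesis
    by (metis R.span_image fun_space.span_minimal fun_space.subspace_span)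
qed

text \<open>Since \<open>\<sigma> (y * x) = \<sigma> x * \<sigma> y\<close>, a left factor becomes a
  right factor under \<sigma>.\<close>

lemma left_op_compose_op:
  assumes "\<And>x y. \<sigma> (x * y) = \<sigma> y * \<sigma> x"
  shows "left_op y (compose_op \<sigma> h) = compose_op \<sigma> (right_op (\<sigma> y) h)"
  by (simp add: left_op_def compose_op_def right_op_def assms)

theorem theorem3p2:
  fixes \<sigma> :: "'s::semigroup_mult \<Rightarrow> 's"
    and f g h\<^sub>1 h\<^sub>2 :: "'s \<Rightarrow> 'f::field"
    and V V\<sigma> :: "('s \<Rightarrow> 'f) set"
  assumes "CHAR('f) \<noteq> 2"
    and "involutive_anti_automorphism \<sigma>"
    and "\<forall>x y. f (x * \<sigma> y) = f x * h\<^sub>1 y + g x * h\<^sub>2 y"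
    and "f \<noteq> g" and "fun_space.independent {f, g}"
    and "h\<^sub>2 \<noteq> (\<lambda>_. 0)"
    and "V = fun_space.span {f, g}"
    and "V\<sigma> = compose_op \<sigma> ` V"
  shows "V\<sigma> = fun_space.span {compose_op \<sigma> f, compose_op \<sigma> g}
    \<and> (\<forall>y. left_op y ` V\<sigma> \<subseteq> V\<sigma>)
    \<and> (\<forall>y. right_op (\<sigma> y) ` V \<subseteq> V)
    \<and> ((\<forall>y. left_op y ` V\<sigma> \<subseteq> V\<sigma>) \<longleftrightarrow> (\<forall>y. right_op (\<sigma> y) ` V \<subseteq> V))"
proof -
  have anti: "\<sigma> (x * y) = \<sigma> y * \<sigma> x" for x y
    using assms(2) by (simp add: involutive_anti_automorphism_def)
  have invol: "\<sigma> (\<sigma> x) = x" for x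
    using assms(2) by (simp add: involutive_anti_automorphism_def pointfree_idE)
  interpret J: Vector_Spaces.linear fscale fscale "compose_op \<sigma> :: ('s \<Rightarrow> 'f) \<Rightarrow> _"
    by (rule linear_compose_op)
  have span: "V\<sigma> = fun_space.span {compose_op \<sigma> f, compose_op \<sigma> g}"
    using J.span_image[of "{f, g}"] assms(7,8) by simp
  obtain y\<^sub>0 where "h\<^sub>2 y\<^sub>0 \<noteq> 0"
    using assms(6) by auto
  \<comment> \<open>After reindexing by \<sigma>, the coefficient of \<open>g\<close> at
    \<open>y\<close> is \<open>h\<^sub>2 (\<sigma> y)\<close>, so the witness becomes
    \<open>\<sigma> y\<^sub>0\<close>.\<close>
  then have "h\<^sub>2 (\<sigma> (\<sigma> y\<^sub>0)) \<noteq> 0"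
    by (simp add: invol)
  \<comment> \<open>Every \<open>y\<close> equals \<open>\<sigma> (\<sigma> y)\<close>, so the
    functional equation governs all right translates of \<open>f\<close>.\<close>
  moreover have "right_op y f = fscale (h\<^sub>1 (\<sigma> y)) f + fscale (h\<^sub>2 (\<sigma> y)) g" for y
    using assms(3)[rule_format, of _ "\<sigma> y"]
    by (simp add: right_op_def fscale_def fun_eq_iff invol mult.commute)
  ultimately have right: "right_op z ` V \<subseteq> V" for z
    unfolding assms(7) by (rule right_op_span_pair_subset[rotated])
  have "left_op y ` V\<sigma> = compose_op \<sigma> ` right_op (\<sigma> y) ` V" for y
    by (simp add: assms(8) image_image left_op_compose_op[OF anti])
  then have left: "left_op y ` V\<sigma> \<subseteq> V\<sigma>" for y
    using right by (simp add: assms(8) image_mono)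
  \<comment> \<open>The equivalence holds because both of its sides have been established.\<close>
  show ?thesis
    using span left right by blast
qed

end
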